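(* Let $L_\tau=(L,\tau)$ be a completely regular topoframe. Then the following statements are equivalent. (1) $L_\tau$ is an extremally disconnected topoframe. (2) $\mathcal{R}L_\tau$ is a Baer ring. (3) Every nonzero ideal in $\mathcal{R}L_\tau$ is essential in a principal ideal generated by an idempotent. (4) $\mathcal{R}L_\tau$ is a $CS$-ring.
   Context: A frame is a complete lattice $L$ (top $\top$, bottom $\bot$) with $a\wedge\bigvee S=\bigvee\{a\wedge s: s\in S\}$ for all $a\in L$, $S\subseteq L$. A frame homomorphism preserves finite meets (including $\top$) and arbitrary joins (including $\bot$). A topoframe $L_\tau$ is a pair $(L,\tau)$ where $L$ is a frame and $\tau$ is a subframe of $L$ all of whose elements are complemented in $L$. The complement in $L$ of a complemented element $a$ is denoted $a'$, and $\tau'=\{t': t\in\tau\}$. A real-continuous function on $L_\tau$ is a frame homomorphism $f:\mathcal{P}(\mathbb{R})\to L$ (where $\mathcal P(\mathbb R)$ is the power set of $\mathbb R$) such that $f(\{x\in\mathbb R: p<x<q\})\in\tau$ for all $p,q\in\mathbb{Q}$. $\mathcal{R}L_\tau$ is the set of all these; it is a commutative (reduced) ring with identity under $(f\diamond g)(X)=\bigvee\{f(Y)\wedge g(Z): Y\diamond Z\subseteq X\}$ for $\diamond\in\{+,\cdot\}$, where $Y\diamond Z=\{y\diamond z: y\in Y, z\in Z\}$, with $(-f)(X)=f(-X)$, and with the constants $\mathbf{r}$ ($r\in\mathbb R$) given by $\mathbf r(X)=\top$ if $r\in X$ and $\bot$ otherwise; $\mathbf 0$ and $\mathbf 1$ are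 the zero and identity. For $f\in\mathcal{R}L_\tau$, $\mathrm{coz}(f)=f(\mathbb{R}\setminus\{0\})$; it belongs to $\tau$. $L_\tau$ is completely regular if every $a\in\tau$ has the form $a=\bigvee_{\lambda\in\Lambda}\mathrm{coz}(f_\lambda)$ for some $\{f_\lambda\}_{\lambda\in\Lambda}\subseteq\mathcal{R}L_\tau$. The closure of $p\in L$ is $\overline{p}=\bigwedge\{x\in\tau': p\le x\}$; $L_\tau$ is extremally disconnected if $\overline a\in\tau$ for all $a\in\tau$. For ideals $I,J$ of a commutative ring $A$ with identity, $I$ is essential in $J$ if $I\subseteq J$ and every nonzero ideal contained in $J$ meets $I$ nontrivially. An ideal is closed if it is not essential in any strictly larger ideal. $A$ is a $CS$-ring if every closed ideal is a direct summand of $A$. $A$ is a Baer ring if for every subset $S\subseteq A$, $\mathrm{Ann}(S)=eA$ for some $e\in A$ with $e^2=e$. *)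

theory Defs
  imports Complex_Main "HOL-Algebra.Ideal"
begin

text \<open>
  The class \<open>complete_distrib_lattice\<close> is not used here: it demands complete distributivity,
  whereas in a frame only binary meets distribute over arbitrary joins. The lattice constants are
  qualified because HOL-Algebra reuses names such as \<open>inf\<close> and \<open>top\<close> for its record-based orders.
\<close>

class frame = complete_lattice +
  assumes frame_distrib: "Lattices.inf a (Sup S) = Sup (Lattices.inf a ` S)"

instance set :: (type) frame
  by standard auto

text \<open>Preservation of the empty join gives preservation of the bottom element.\<close>

definition frame_hom :: "('a::frame \<Rightarrow> 'b::frame) \<Rightarrow> bool" where
  "frame_hom f \<longleftrightarrow>
     f Orderings.top = Orderings.top \<and>
     (\<forall>a b. f (Lattices.inf a b) = Lattices.inf (f a) (f b)) \<and>
     (\<forall>S. f (Sup S) = Sup (f ` S))"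

definition is_complement :: "'a::bounded_lattice \<Rightarrow> 'a \<Rightarrow> bool" where
  "is_complement a b \<longleftrightarrow> Lattices.inf a b = Orderings.bot \<and> Lattices.sup a b = Orderings.top"

definition complemented :: "'a::bounded_lattice \<Rightarrow> bool" where
  "complemented a \<longleftrightarrow> (\<exists>b. is_complement a b)"

definition frame_compl :: "'a::bounded_lattice \<Rightarrow> 'a" where
  "frame_compl a = (THE b. is_complement a b)"

lemma frame_complement_unique:
  fixes a :: "'a::frame"
  assumes "is_complement a b" and "is_complement a c"
  shows "b = c"
proof -
  have le: "y \<le> z" if y: "is_complement a y" and z: "is_complement a z" for y z :: 'a
  proof -
    have "y = Lattices.inf y (Sup {a, z})"
      using z by (simp add: is_complement_def)
    also have "\<dots> = Lattices.sup (Lattices.inf y a) (Lattices.inf y z)"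
      by (simp add: frame_distrib del: Sup_insert) simp
    also have "\<dots> = Lattices.inf y z"
      using y by (simp add: is_complement_def inf_commute)
    finally show ?thesis
      by (metis inf_le2)
  qed
  show ?thesis
    using le[OF assms] le[OF assms(2,1)] by (rule antisym)
qed

lemma is_complement_frame_compl:
  fixes a :: "'a::frame"
  assumes "complemented a"
  shows "is_complement a (frame_compl a)"
  using assms unfolding frame_compl_def complemented_def
  by (metis (mono_tags, lifting) frame_complement_unique theI)

text \<open>The frame \<open>L\<close> is the whole type; the topoframe is given by the set \<open>\<tau>\<close>.\<close>

definition subframe :: "'a::frame set \<Rightarrow> bool" where
  "subframe T \<longleftrightarrow>
     Orderings.top \<in> T \<and>
     (\<forall>a\<in>T. \<forall>b\<in>T. Lattices.inf a b \<in> T) \<and>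
     (\<forall>S\<subseteq>T. Sup S \<in> T)"

locale topoframe =
  fixes \<tau> :: "'a::frame set"
  assumes subframe_tau: "subframe \<tau>"
    and complemented_tau: "t \<in> \<tau> \<Longrightarrow> complemented t"

definition tf_closure :: "'a::frame set \<Rightarrow> 'a \<Rightarrow> 'a" where
  "tf_closure \<tau> p = Inf {x \<in> frame_compl ` \<tau>. p \<le> x}"

definition extremally_disconnected :: "'a::frame set \<Rightarrow> bool" where
  "extremally_disconnected \<tau> \<longleftrightarrow> (\<forall>a\<in>\<tau>. tf_closure \<tau> a \<in> \<tau>)"

definition real_continuous :: "'a::frame set \<Rightarrow> (real set \<Rightarrow> 'a) \<Rightarrow> bool" where
  "real_continuous \<tau> f \<longleftrightarrow>
     frame_hom f \<and> (\<forall>p q :: rat. f {x. of_rat p < x \<and> x < of_rat q} \<in> \<tau>)"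

definition rc_op ::
  "(real \<Rightarrow> real \<Rightarrow> real) \<Rightarrow> (real set \<Rightarrow> 'a::frame) \<Rightarrow> (real set \<Rightarrow> 'a) \<Rightarrow> real set \<Rightarrow> 'a" where
  "rc_op h f g X = Sup {Lattices.inf (f Y) (g Z) | Y Z. {h y z | y z. y \<in> Y \<and> z \<in> Z} \<subseteq> X}"

definition rc_const :: "real \<Rightarrow> real set \<Rightarrow> 'a::frame" where
  "rc_const r X = (if r \<in> X then Orderings.top else Orderings.bot)"

definition RL :: "'a::frame set \<Rightarrow> (real set \<Rightarrow> 'a) ring" where
  "RL \<tau> = \<lparr>carrier = {f. real_continuous \<tau> f},
           mult = rc_op (*), one = rc_const 1,
           zero = rc_const 0, add = rc_op (+)\<rparr>"

definition coz :: "(real set \<Rightarrow> 'a::frame) \<Rightarrow> 'a" where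
  "coz f = f (UNIV - {0})"

definition completely_regular :: "'a::frame set \<Rightarrow> bool" where
  "completely_regular \<tau> \<longleftrightarrow> (\<forall>a\<in>\<tau>. \<exists>F \<subseteq> carrier (RL \<tau>). a = Sup (coz ` F))"

definition essential_in :: "('a, 'm) ring_scheme \<Rightarrow> 'a set \<Rightarrow> 'a set \<Rightarrow> bool" where
  "essential_in R I J \<longleftrightarrow>
     ideal I R \<and> ideal J R \<and> I \<subseteq> J \<and>
     (\<forall>K. ideal K R \<and> K \<noteq> {\<zero>\<^bsub>R\<^esub>} \<and> K \<subseteq> J \<longrightarrow> K \<inter> I \<noteq> {\<zero>\<^bsub>R\<^esub>})"

definition closed_ideal :: "('a, 'm) ring_scheme \<Rightarrow> 'a set \<Rightarrow> bool" where
  "closed_ideal R I \<longleftrightarrow> ideal I R \<and> \<not> (\<exists>J. ideal J R \<and> I \<subset> J \<and> essential_in R I J)"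

definition direct_summand :: "('a, 'm) ring_scheme \<Rightarrow> 'a set \<Rightarrow> bool" where
  "direct_summand R I \<longleftrightarrow>
     ideal I R \<and> (\<exists>K. ideal K R \<and> I <+>\<^bsub>R\<^esub> K = carrier R \<and> I \<inter> K = {\<zero>\<^bsub>R\<^esub>})"

definition CS_ring :: "('a, 'm) ring_scheme \<Rightarrow> bool" where
  "CS_ring R \<longleftrightarrow> (\<forall>I. closed_ideal R I \<longrightarrow> direct_summand R I)"

definition annihilator :: "('a, 'm) ring_scheme \<Rightarrow> 'a set \<Rightarrow> 'a set" where
  "annihilator R S = {x \<in> carrier R. \<forall>s\<in>S. x \<otimes>\<^bsub>R\<^esub> s = \<zero>\<^bsub>R\<^esub>}"

definition idempotent_elem :: "('a, 'm) ring_scheme \<Rightarrow> 'a \<Rightarrow> bool" where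
  "idempotent_elem R e \<longleftrightarrow> e \<in> carrier R \<and> e \<otimes>\<^bsub>R\<^esub> e = e"

definition Baer_ring :: "('a, 'm) ring_scheme \<Rightarrow> bool" where
  "Baer_ring R \<longleftrightarrow> (\<forall>S \<subseteq> carrier R. \<exists>e. idempotent_elem R e \<and> annihilator R S = PIdl\<^bsub>R\<^esub> e)"

end

theory Submission
  imports Defs "HOL-Algebra.Multiplicative_Group"
begin

text \<open>
  The last three conditions are equivalent in every reduced commutative ring. In such a ring an
  ideal \<open>I\<close> is essential in an ideal \<open>J \<supseteq> I\<close> exactly when \<open>J\<close> meets the annihilator of \<open>I\<close>
  trivially (\<open>essential_in_iff_annihilator\<close>). For an idempotent \<open>e\<close> it follows that \<open>I\<close> is essential in
  \<open>eR\<close> exactly when \<open>Ann I = (1 - e)R\<close> (\<open>essential_in_PIdl_iff\<close>), so the third condition is the Baer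
  condition in disguise. The same criterion shows that \<open>Ann (Ann I)\<close> is a closed ideal in which \<open>I\<close> is
  essential. Since the direct summands are the ideals \<open>eR\<close>, a CS-ring has every ideal essential
  in some \<open>eR\<close>; conversely, a closed ideal that is essential in \<open>eR\<close> equals \<open>eR\<close>.

  The topoframe enters through cozero elements, which turn the ring into order theory: \<open>fg = 0\<close> iff
  \<open>coz f\<close> and \<open>coz g\<close> are disjoint. The annihilator of a set \<open>S\<close> therefore consists of the \<open>f\<close> whose
  cozero element lies below the exterior of \<open>\<Squnion>(coz ` S)\<close> (\<open>annihilator_RL\<close>), where the exterior of
  \<open>a\<close> is the largest member of \<open>\<tau>\<close> disjoint from \<open>a\<close>. The closure of \<open>a\<close> is the complement
  of its exterior, so extremal disconnectedness says that the exteriors of members of \<open>\<tau>\<close> have their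
  complements in \<open>\<tau>\<close>. The elements of \<open>\<tau>\<close> with complement in \<open>\<tau>\<close> are the cozero elements of
  idempotents \<open>e\<close>, and \<open>eR\<close> is the set of \<open>f\<close> with \<open>coz f \<le> coz e\<close>. Complete regularity makes every
  member of \<open>\<tau>\<close> the join \<open>\<Squnion>(coz ` S)\<close> for some \<open>S\<close> and identifies an exterior by the cozero
  elements below it; this matches the Baer condition with extremal disconnectedness.

  The real-continuous functions form a reduced commutative ring because a frame
  homomorphism from a power set amounts to a partition of \<open>\<top>\<close> into pairwise disjoint pieces, one for each
  point, much like the law of a random variable. Finitely many of them have a common
  refinement \<open>J\<close>, of which each is an image under an ordinary function, and the operation \<open>rc_op h\<close>
  acts on such images pointwise (\<open>rc_op_pushforward\<close>). Ring identities and the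
  rules for cozero elements are then inherited from the reals.
\<close>

text \<open>The symbols of the record-based orders make room for those of the lattice type classes.\<close>

no_notation meet (infixl \<open>\<sqinter>\<index>\<close> 70)
  and join (infixl \<open>\<squnion>\<index>\<close> 65)
  and Order.top (\<open>\<top>\<index>\<close>)
  and Order.bottom (\<open>\<bottom>\<index>\<close>)
  and Lattice.inf (\<open>(\<open>open_block notation=\<open>prefix \<Sqinter>\<close>\<close>\<Sqinter>\<index>_)\<close> [90] 90)
  and Lattice.sup (\<open>(\<open>open_block notation=\<open>prefix \<Squnion>\<close>\<close>\<Squnion>\<index>_)\<close> [90] 90)
unbundle lattice_syntax

section \<open>Essential ideals and annihilators in reduced rings\<close>

context cring
begin

text \<open>Closure under negation comes for free, as \<open>\<ominus> a = (\<ominus> \<one>) \<otimes> a\<close>.\<close>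

lemma idealI_cring:
  assumes "I \<subseteq> carrier R" "\<zero> \<in> I" "\<And>x y. \<lbrakk>x \<in> I; y \<in> I\<rbrakk> \<Longrightarrow> x \<oplus> y \<in> I"
    and mult: "\<And>x a. \<lbrakk>x \<in> carrier R; a \<in> I\<rbrakk> \<Longrightarrow> x \<otimes> a \<in> I"
  shows "ideal I R"
proof (rule idealI[OF ring_axioms])
  have neg: "\<ominus> a \<in> I" if "a \<in> I" for a
  proof -
    have "\<ominus> a = \<ominus> \<one> \<otimes> a"
      using that assms(1) by (simp add: l_minus subset_iff)
    then show ?thesis
      using mult[of "\<ominus> \<one>" a] that by simp
  qed
  show "subgroup I (add_monoid R)"
    using assms neg by (auto intro!: group.subgroupI[OF a_group] simp: a_inv_def[symmetric])
next
  fix a x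
  assume "a \<in> I" "x \<in> carrier R"
  then show "x \<otimes> a \<in> I" "a \<otimes> x \<in> I"
    using mult[of x a] assms(1) by (auto simp: m_comm subset_iff)
qed

lemma ideal_subset_carrier:
  assumes "ideal I R"
  shows "I \<subseteq> carrier R"
  using assms by (rule additive_subgroup.a_subset[OF ideal.axioms(1)])

lemma annihilator_subset_carrier: "annihilator R S \<subseteq> carrier R"
  by (auto simp: annihilator_def)

lemma subset_double_annihilator:
  assumes S: "S \<subseteq> carrier R"
  shows "S \<subseteq> annihilator R (annihilator R S)"
proof
  fix s assume s: "s \<in> S"
  have "s \<otimes> x = \<zero>" if "x \<in> annihilator R S" for x
    using that s S m_comm[of s x] unfolding annihilator_def by auto
  then show "s \<in> annihilator R (annihilator R S)"
    using s S unfolding annihilator_def by blast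
qed

lemma annihilator_ideal:
  assumes "S \<subseteq> carrier R"
  shows "ideal (annihilator R S) R"
  using assms
  by (intro idealI_cring) (auto simp: annihilator_def subset_iff l_distr m_assoc)

text \<open>The elements killed by \<open>Ann S\<close> form an ideal containing \<open>S\<close>, hence containing \<open>Idl S\<close>. This
  reduces the Baer condition to annihilators of ideals.\<close>

lemma annihilator_genideal:
  assumes S: "S \<subseteq> carrier R"
  shows "annihilator R (Idl S) = annihilator R S"
proof
  show "annihilator R (Idl S) \<subseteq> annihilator R S"
    using genideal_self[OF S] by (auto simp: annihilator_def)
next
  have "ideal (annihilator R (annihilator R S)) R"
    using annihilator_subset_carrier by (rule annihilator_ideal)
  moreover have "S \<subseteq> annihilator R (annihilator R S)"
    using S by (rule subset_double_annihilator)
  ultimately have "Idl S \<subseteq> annihilator R (annihilator R S)"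
    by (rule genideal_minimal)
  then have "t \<otimes> s = \<zero>" if "t \<in> annihilator R S" "s \<in> Idl S" for s t
  proof -
    have "s \<in> annihilator R (annihilator R S)"
      using that \<open>Idl S \<subseteq> _\<close> by blast
    then show ?thesis
      using that(1) by (auto simp: annihilator_def m_comm)
  qed
  then show "annihilator R S \<subseteq> annihilator R (Idl S)"
    by (auto simp: annihilator_def)
qed

lemma add_one_minus: "e \<in> carrier R \<Longrightarrow> e \<oplus> (\<one> \<ominus> e) = \<one>"
  by (simp add: minus_eq a_assoc[symmetric] a_comm r_neg r_neg2)

lemma idempotent_complement:
  assumes "idempotent_elem R e"
  shows "idempotent_elem R (\<one> \<ominus> e)" and "e \<otimes> (\<one> \<ominus> e) = \<zero>"
    and "\<one> \<ominus> (\<one> \<ominus> e) = e"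
proof -
  have e: "e \<in> carrier R" "e \<otimes> e = e"
    using assms by (auto simp: idempotent_elem_def)
  show z: "e \<otimes> (\<one> \<ominus> e) = \<zero>"
    using e by (simp add: minus_eq r_distr r_minus r_neg)
  have "(\<one> \<ominus> e) \<otimes> (\<one> \<ominus> e) = \<one> \<otimes> (\<one> \<ominus> e) \<oplus> \<ominus> (e \<otimes> (\<one> \<ominus> e))"
    using e by (simp add: minus_eq l_distr l_minus)
  then show "idempotent_elem R (\<one> \<ominus> e)"
    using e z by (simp add: idempotent_elem_def)
  show "\<one> \<ominus> (\<one> \<ominus> e) = e"
    using e by (simp add: minus_eq minus_add a_assoc[symmetric] r_neg)
qed

lemma mem_PIdl_idempotent:
  assumes e: "idempotent_elem R e"
  shows "x \<in> PIdl e \<longleftrightarrow> x \<in> carrier R \<and> x \<otimes> e = x"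
proof -
  have "e \<in> carrier R" "e \<otimes> e = e"
    using e by (auto simp: idempotent_elem_def)
  then show ?thesis
    by (auto simp: cgenideal_def m_assoc) (metis)
qed

text \<open>Ideals generated by idempotents are themselves annihilators.\<close>

lemma mem_PIdl_idempotent_iff_annihilates:
  assumes e: "idempotent_elem R e"
  shows "x \<in> PIdl e \<longleftrightarrow> x \<in> carrier R \<and> x \<otimes> (\<one> \<ominus> e) = \<zero>"
proof -
  have "x \<otimes> (\<one> \<ominus> e) = x \<ominus> x \<otimes> e" if "x \<in> carrier R"
    using e that by (simp add: idempotent_elem_def minus_eq r_distr r_minus)
  then show ?thesis
    using e r_right_minus_eq[of x "x \<otimes> e"]
    unfolding mem_PIdl_idempotent[OF e] idempotent_elem_def by (metis m_closed)
qed

text \<open>A decomposition \<open>R = J \<oplus> K\<close> splits the identity as \<open>\<one> = e \<oplus> k\<close>, and \<open>e\<close> is an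
  idempotent generating \<open>J\<close> because \<open>x \<otimes> k\<close> lies in \<open>J \<inter> K\<close> for every \<open>x\<close> in \<open>J\<close>.\<close>

lemma direct_summand_iff_PIdl_idempotent:
  "direct_summand R J \<longleftrightarrow> (\<exists>e. idempotent_elem R e \<and> J = PIdl e)"
proof
  assume "direct_summand R J"
  then obtain K where J: "ideal J R" and K: "ideal K R"
    and sum: "J <+>\<^bsub>R\<^esub> K = carrier R" and disj: "J \<inter> K = {\<zero>}"
    by (auto simp: direct_summand_def)
  interpret J: ideal J R by (rule J)
  interpret K: ideal K R by (rule K)
  have "\<one> \<in> J <+>\<^bsub>R\<^esub> K"
    using sum by simp
  then obtain e k where e: "e \<in> J" and k: "k \<in> K" and one: "\<one> = e \<oplus> k"
    by (auto simp: set_add_defs)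
  have carr: "e \<in> carrier R" "k \<in> carrier R"
    using e k J.Icarr K.Icarr by auto
  have fix_e: "x \<otimes> e = x" if x: "x \<in> J" for x
  proof -
    have xc: "x \<in> carrier R"
      using x by (rule J.Icarr)
    have "x \<otimes> k \<in> J \<inter> K"
      using x xc k carr by (simp add: J.I_r_closed K.I_l_closed)
    then have "x \<otimes> k = \<zero>"
      using disj by simp
    moreover have "x = x \<otimes> e \<oplus> x \<otimes> k"
      using xc carr one by (metis r_distr r_one)
    ultimately show ?thesis
      using xc carr by simp
  qed
  have idem: "idempotent_elem R e"
    using carr fix_e[OF e] by (simp add: idempotent_elem_def)
  have "J = PIdl e"
  proof
    show "J \<subseteq> PIdl e"
      using fix_e J.Icarr by (auto simp: mem_PIdl_idempotent[OF idem])
    show "PIdl e \<subseteq> J"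
      using J e by (rule cgenideal_minimal)
  qed
  then show "\<exists>e. idempotent_elem R e \<and> J = PIdl e"
    using idem by blast
next
  assume "\<exists>e. idempotent_elem R e \<and> J = PIdl e"
  then obtain e where e: "idempotent_elem R e" and J: "J = PIdl e"
    by blast
  let ?f = "\<one> \<ominus> e"
  note f = idempotent_complement[OF e]
  have carr: "e \<in> carrier R" "?f \<in> carrier R"
    using e by (auto simp: idempotent_elem_def)
  have "carrier R \<subseteq> PIdl e <+>\<^bsub>R\<^esub> PIdl ?f"
  proof
    fix x assume x: "x \<in> carrier R"
    have "\<one> = e \<oplus> ?f"
      using carr by (simp add: add_one_minus)
    then have "x = x \<otimes> e \<oplus> x \<otimes> ?f"
      using x carr by (metis r_distr r_one)
    moreover have "x \<otimes> e \<in> PIdl e" "x \<otimes> ?f \<in> PIdl ?f"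
      using x by (auto simp: cgenideal_def)
    ultimately show "x \<in> PIdl e <+>\<^bsub>R\<^esub> PIdl ?f"
      by (auto simp: set_add_defs)
  qed
  moreover have "PIdl e <+>\<^bsub>R\<^esub> PIdl ?f \<subseteq> carrier R"
    using carr by (auto simp: set_add_defs cgenideal_def)
  moreover have "PIdl e \<inter> PIdl ?f = {\<zero>}"
  proof
    show "PIdl e \<inter> PIdl ?f \<subseteq> {\<zero>}"
      by (auto simp: mem_PIdl_idempotent_iff_annihilates[OF e] mem_PIdl_idempotent[OF f(1)])
    show "{\<zero>} \<subseteq> PIdl e \<inter> PIdl ?f"
      using carr by (auto simp: mem_PIdl_idempotent[OF e] mem_PIdl_idempotent[OF f(1)])
  qed
  ultimately show "direct_summand R J"
    using J carr cgenideal_ideal by (auto simp: direct_summand_def intro!: exI[of _ "PIdl ?f"])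
qed

end

locale reduced_cring = cring +
  assumes reduced: "\<lbrakk>x \<in> carrier R; x \<otimes> x = \<zero>\<rbrakk> \<Longrightarrow> x = \<zero>"

context reduced_cring
begin

text \<open>An element of \<open>I\<close> that kills \<open>I\<close> has square zero, so \<open>Ann I\<close> meets \<open>I\<close> trivially, and
  \<open>J \<inter> Ann I\<close> would be an obstruction to essentiality. Conversely, any obstruction \<open>K\<close> satisfies
  \<open>KI \<subseteq> K \<inter> I = 0\<close> and thus lies in \<open>J \<inter> Ann I\<close>.\<close>

lemma essential_in_iff_annihilator:
  assumes I: "ideal I R" and J: "ideal J R"
  shows "essential_in R I J \<longleftrightarrow> I \<subseteq> J \<and> J \<inter> annihilator R I = {\<zero>}"
proof -
  interpret I: ideal I R by (rule I)
  interpret J: ideal J R by (rule J)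
  have Isub: "I \<subseteq> carrier R"
    using I.Icarr by blast
  interpret N: ideal "annihilator R I" R
    using Isub by (rule annihilator_ideal)
  have meet: "ideal (J \<inter> annihilator R I) R"
    using J N.ideal_axioms by (rule i_intersect)
  have square: "x = \<zero>" if "x \<in> annihilator R I" "x \<in> I" for x
    using that unfolding annihilator_def by (blast intro: reduced[of x])
  show ?thesis
  proof
    assume ess: "essential_in R I J"
    have "(J \<inter> annihilator R I) \<inter> I = {\<zero>}"
      using square I.zero_closed J.zero_closed N.zero_closed by blast
    then show "I \<subseteq> J \<and> J \<inter> annihilator R I = {\<zero>}"
      using ess meet unfolding essential_in_def by blast
  next
    assume *: "I \<subseteq> J \<and> J \<inter> annihilator R I = {\<zero>}"
    have "K \<inter> I \<noteq> {\<zero>}" if K: "ideal K R" "K \<noteq> {\<zero>}" "K \<subseteq> J" for K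
    proof
      assume disj: "K \<inter> I = {\<zero>}"
      interpret K: ideal K R by (rule K(1))
      have "x \<otimes> y = \<zero>" if "x \<in> K" "y \<in> I" for x y
      proof -
        have "x \<otimes> y \<in> K \<inter> I"
          using K.I_r_closed[OF that(1) I.Icarr[OF that(2)]] I.I_l_closed[OF that(2) K.Icarr[OF that(1)]]
          by blast
        then show ?thesis
          using disj by simp
      qed
      then have "K \<subseteq> J \<inter> annihilator R I"
        using K(3) K.Icarr unfolding annihilator_def by blast
      then show False
        using * K(2) K.zero_closed by blast
    qed
    then show "essential_in R I J"
      using * I J unfolding essential_in_def by blast
  qed
qed

text \<open>The two halves of the essentiality criterion become the two inclusions: \<open>I \<subseteq> eR\<close> says that \<open>1 - e\<close>
  kills \<open>I\<close>, and \<open>eR \<inter> Ann I = 0\<close> says that \<open>x \<otimes> e = \<zero>\<close> for every \<open>x\<close> in \<open>Ann I\<close>.\<close>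

lemma essential_in_PIdl_iff:
  assumes I: "ideal I R" and e: "idempotent_elem R e"
  shows "essential_in R I (PIdl e) \<longleftrightarrow> annihilator R I = PIdl (\<one> \<ominus> e)"
proof -
  note f = idempotent_complement[OF e]
  have ec: "e \<in> carrier R" "e \<otimes> e = e"
    using e by (auto simp: idempotent_elem_def)
  interpret I: ideal I R by (rule I)
  have Isub: "I \<subseteq> carrier R"
    using I.Icarr by blast
  have mem_f: "x \<in> PIdl (\<one> \<ominus> e) \<longleftrightarrow> x \<in> carrier R \<and> x \<otimes> e = \<zero>" for x
    using mem_PIdl_idempotent_iff_annihilates[OF f(1)] f(3) by simp
  have f_ann: "I \<subseteq> PIdl e \<longleftrightarrow> PIdl (\<one> \<ominus> e) \<subseteq> annihilator R I"
  proof
    assume "I \<subseteq> PIdl e"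
    then have y: "y \<otimes> (\<one> \<ominus> e) = \<zero>" if "y \<in> I" for y
      using that by (auto simp: mem_PIdl_idempotent_iff_annihilates[OF e])
    show "PIdl (\<one> \<ominus> e) \<subseteq> annihilator R I"
    proof
      fix x assume x: "x \<in> PIdl (\<one> \<ominus> e)"
      have "x \<otimes> y = \<zero>" if "y \<in> I" for y
      proof -
        have carr: "x \<in> carrier R" "y \<in> carrier R"
          using x that Isub by (auto simp: mem_f)
        have "x \<otimes> y = (x \<otimes> (\<one> \<ominus> e)) \<otimes> y"
          using x by (simp add: mem_PIdl_idempotent[OF f(1)])
        also have "\<dots> = x \<otimes> (y \<otimes> (\<one> \<ominus> e))"
          using carr ec by (simp add: m_ac)
        finally show ?thesis
          using carr y[OF that] by simp
      qed
      then show "x \<in> annihilator R I"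
        using x by (simp add: annihilator_def mem_f)
    qed
  next
    assume *: "PIdl (\<one> \<ominus> e) \<subseteq> annihilator R I"
    have "\<one> \<ominus> e \<in> annihilator R I"
      using * ec cgenideal_self[of "\<one> \<ominus> e"] by auto
    then show "I \<subseteq> PIdl e"
      using Isub ec by (auto simp: annihilator_def mem_PIdl_idempotent_iff_annihilates[OF e] subset_iff m_comm)
  qed
  have "PIdl e \<inter> annihilator R I = {\<zero>} \<longleftrightarrow> annihilator R I \<subseteq> PIdl (\<one> \<ominus> e)"
  proof
    interpret N: ideal "annihilator R I" R
      using Isub by (rule annihilator_ideal)
    {
      assume *: "PIdl e \<inter> annihilator R I = {\<zero>}"
      show "annihilator R I \<subseteq> PIdl (\<one> \<ominus> e)"
      proof
        fix x assume x: "x \<in> annihilator R I"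
        then have "x \<otimes> e \<in> PIdl e \<inter> annihilator R I"
          using ec N.Icarr by (auto simp: cgenideal_def N.I_r_closed)
        then show "x \<in> PIdl (\<one> \<ominus> e)"
          using * x N.Icarr by (auto simp: mem_f)
      qed
    next
      assume "annihilator R I \<subseteq> PIdl (\<one> \<ominus> e)"
      then show "PIdl e \<inter> annihilator R I = {\<zero>}"
        using N.zero_closed ec by (auto simp: mem_PIdl_idempotent[OF e] mem_f subset_iff)
    }
  qed
  then show ?thesis
    using f_ann essential_in_iff_annihilator[OF I cgenideal_ideal[OF ec(1)]] by blast
qed

lemma Baer_ring_iff_essential_in_PIdl:
  "Baer_ring R \<longleftrightarrow>
    (\<forall>I. ideal I R \<and> I \<noteq> {\<zero>} \<longrightarrow> (\<exists>e. idempotent_elem R e \<and> essential_in R I (PIdl e)))"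
proof
  assume B: "Baer_ring R"
  show "\<forall>I. ideal I R \<and> I \<noteq> {\<zero>} \<longrightarrow> (\<exists>e. idempotent_elem R e \<and> essential_in R I (PIdl e))"
  proof (intro allI impI)
    fix I assume "ideal I R \<and> I \<noteq> {\<zero>}"
    then have I: "ideal I R"
      by blast
    then have "I \<subseteq> carrier R"
      by (rule ideal_subset_carrier)
    then obtain e where e: "idempotent_elem R e" "annihilator R I = PIdl e"
      using B unfolding Baer_ring_def by blast
    note f = idempotent_complement[OF e(1)]
    have "essential_in R I (PIdl (\<one> \<ominus> e))"
      using essential_in_PIdl_iff[OF I f(1)] f(3) e(2) by simp
    then show "\<exists>e. idempotent_elem R e \<and> essential_in R I (PIdl e)"
      using f(1) by blast
  qed
next
  assume *: "\<forall>I. ideal I R \<and> I \<noteq> {\<zero>} \<longrightarrow> (\<exists>e. idempotent_elem R e \<and> essential_in R I (PIdl e))"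
  show "Baer_ring R"
    unfolding Baer_ring_def
  proof (intro allI impI)
    fix S assume S: "S \<subseteq> carrier R"
    have I: "ideal (Idl S) R"
      using S by (rule genideal_ideal)
    show "\<exists>e. idempotent_elem R e \<and> annihilator R S = PIdl e"
    proof (cases "Idl S = {\<zero>}")
      \<comment> \<open>The hypothesis covers nonzero ideals only; the zero ideal has annihilator \<open>1R\<close>.\<close>
      case True
      then have "annihilator R S = annihilator R {\<zero>}"
        using annihilator_genideal[OF S] by simp
      also have "\<dots> = PIdl \<one>"
        using cgenideal_eq_genideal[OF one_closed] genideal_one by (auto simp: annihilator_def)
      finally have "annihilator R S = PIdl \<one>" .
      moreover have "idempotent_elem R \<one>"
        by (simp add: idempotent_elem_def)
      ultimately show ?thesis
        by blast
    next
      case False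
      then obtain e where e: "idempotent_elem R e" "essential_in R (Idl S) (PIdl e)"
        using * I by blast
      then have "annihilator R S = PIdl (\<one> \<ominus> e)"
        using essential_in_PIdl_iff[OF I] annihilator_genideal[OF S] by simp
      then show ?thesis
        using idempotent_complement(1)[OF e(1)] by blast
    qed
  qed
qed

text \<open>If \<open>Ann T\<close> is essential in \<open>J\<close>, then \<open>J\<close> meets \<open>Ann (Ann T)\<close> trivially. For \<open>m\<close> in \<open>J\<close> and
  \<open>y\<close> in \<open>T\<close> the product \<open>m \<otimes> y\<close> lies in both, so \<open>m\<close> is already in \<open>Ann T\<close>.\<close>

lemma annihilator_closed_ideal:
  assumes T: "T \<subseteq> carrier R"
  shows "closed_ideal R (annihilator R T)"
proof -
  let ?N = "annihilator R T"
  have N: "ideal ?N R"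
    using T by (rule annihilator_ideal)
  have "J \<subseteq> ?N" if J: "ideal J R" and ess: "essential_in R ?N J" for J
  proof
    fix m assume m: "m \<in> J"
    interpret J: ideal J R by (rule J)
    interpret NN: ideal "annihilator R ?N" R
      using annihilator_subset_carrier by (rule annihilator_ideal)
    have zero: "J \<inter> annihilator R ?N = {\<zero>}"
      using ess essential_in_iff_annihilator[OF N J] by simp
    have "m \<otimes> y = \<zero>" if y: "y \<in> T" for y
    proof -
      have "y \<in> annihilator R ?N"
        using y subset_double_annihilator[OF T] by blast
      then have "m \<otimes> y \<in> J \<inter> annihilator R ?N"
        using J.I_r_closed[OF m NN.Icarr] NN.I_l_closed[OF _ J.Icarr[OF m]] by blast
      then show ?thesis
        using zero by simp
    qed
    then show "m \<in> ?N"
      using m J.Icarr unfolding annihilator_def by blast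
  qed
  then show ?thesis
    using N unfolding closed_ideal_def by blast
qed

lemma essential_in_double_annihilator:
  assumes I: "ideal I R"
  shows "essential_in R I (annihilator R (annihilator R I))"
proof -
  have Isub: "I \<subseteq> carrier R"
    using I by (rule ideal_subset_carrier)
  interpret N: ideal "annihilator R I" R
    using Isub by (rule annihilator_ideal)
  interpret NN: ideal "annihilator R (annihilator R I)" R
    using annihilator_subset_carrier by (rule annihilator_ideal)
  have "I \<subseteq> annihilator R (annihilator R I)"
    using Isub by (rule subset_double_annihilator)
  moreover have "x = \<zero>" if "x \<in> annihilator R (annihilator R I)" "x \<in> annihilator R I" for x
    using that unfolding annihilator_def by (blast intro: reduced[of x])
  ultimately show ?thesis
    using N.zero_closed NN.zero_closed
    by (subst essential_in_iff_annihilator[OF I NN.ideal_axioms]) blast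
qed

text \<open>The double annihilator of \<open>I\<close> is a closed ideal in which \<open>I\<close> is essential, and over a CS-ring it
  is a direct summand \<open>eR\<close>. Conversely, closedness leaves no room between \<open>I\<close> and an \<open>eR\<close> in which
  it is essential.\<close>

lemma CS_ring_iff_essential_in_PIdl:
  "CS_ring R \<longleftrightarrow>
    (\<forall>I. ideal I R \<and> I \<noteq> {\<zero>} \<longrightarrow> (\<exists>e. idempotent_elem R e \<and> essential_in R I (PIdl e)))"
proof
  assume CS: "CS_ring R"
  show "\<forall>I. ideal I R \<and> I \<noteq> {\<zero>} \<longrightarrow> (\<exists>e. idempotent_elem R e \<and> essential_in R I (PIdl e))"
  proof (intro allI impI)
    fix I assume "ideal I R \<and> I \<noteq> {\<zero>}"
    then have I: "ideal I R"
      by blast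
    have "closed_ideal R (annihilator R (annihilator R I))"
      using annihilator_subset_carrier by (rule annihilator_closed_ideal)
    then obtain e where "idempotent_elem R e" "annihilator R (annihilator R I) = PIdl e"
      using CS unfolding CS_ring_def direct_summand_iff_PIdl_idempotent by blast
    then show "\<exists>e. idempotent_elem R e \<and> essential_in R I (PIdl e)"
      using essential_in_double_annihilator[OF I] by auto
  qed
next
  assume *: "\<forall>I. ideal I R \<and> I \<noteq> {\<zero>} \<longrightarrow> (\<exists>e. idempotent_elem R e \<and> essential_in R I (PIdl e))"
  show "CS_ring R"
    unfolding CS_ring_def direct_summand_iff_PIdl_idempotent
  proof (intro allI impI)
    fix I assume closed: "closed_ideal R I"
    show "\<exists>e. idempotent_elem R e \<and> I = PIdl e"
    proof (cases "I = {\<zero>}")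
      case True
      then have "I = PIdl \<zero>"
        using zero_closed by (auto simp: cgenideal_def intro!: exI[of _ "\<zero>"])
      moreover have "idempotent_elem R \<zero>"
        by (simp add: idempotent_elem_def)
      ultimately show ?thesis
        by blast
    next
      case False
      then obtain e where e: "idempotent_elem R e" "essential_in R I (PIdl e)"
        using * closed unfolding closed_ideal_def by blast
      then have "I = PIdl e"
        using closed unfolding closed_ideal_def essential_in_def by blast
      then show ?thesis
        using e(1) by blast
    qed
  qed
qed

end


section \<open>Common refinements of frame-valued partitions\<close>

lemma inf_Sup_frame: "(a::'a::frame) \<sqinter> \<Squnion>S = (\<Squnion>s\<in>S. a \<sqinter> s)"
  by (rule frame_distrib)

lemma inf_SUP_frame: "(a::'a::frame) \<sqinter> (\<Squnion>i\<in>I. g i) = (\<Squnion>i\<in>I. a \<sqinter> g i)"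
  by (simp add: frame_distrib image_image)

lemma SUP_inf_frame: "(\<Squnion>i\<in>I. g i) \<sqinter> (a::'a::frame) = (\<Squnion>i\<in>I. g i \<sqinter> a)"
  using inf_SUP_frame[of a g I] by (simp add: inf_commute)

lemma inf_sup_frame: "(a::'a::frame) \<sqinter> (b \<squnion> c) = (a \<sqinter> b) \<squnion> (a \<sqinter> c)"
  using frame_distrib[of a "{b, c}"] by simp

lemma inf_le_bot_iff_le_complement:
  fixes a :: "'a::frame"
  assumes "is_complement a b"
  shows "x \<sqinter> a = \<bottom> \<longleftrightarrow> x \<le> b"
proof
  assume "x \<sqinter> a = \<bottom>"
  then have "x = x \<sqinter> b"
    using assms inf_sup_frame[of x a b] by (simp add: is_complement_def)
  then show "x \<le> b"
    by (metis inf_le2)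
next
  assume "x \<le> b"
  then have "x \<sqinter> a \<le> a \<sqinter> b"
    by (simp add: le_infI1)
  then show "x \<sqinter> a = \<bottom>"
    using assms unfolding is_complement_def by (metis bot_unique)
qed

lemma is_complement_sym: "is_complement a b \<Longrightarrow> is_complement b a"
  by (simp add: is_complement_def inf_commute sup_commute)

lemma frame_hom_top: "frame_hom f \<Longrightarrow> f \<top> = \<top>"
  and frame_hom_inf: "frame_hom f \<Longrightarrow> f (a \<sqinter> b) = f a \<sqinter> f b"
  and frame_hom_Sup: "frame_hom f \<Longrightarrow> f (\<Squnion>S) = (\<Squnion>s\<in>S. f s)"
  by (simp_all add: frame_hom_def)

lemma frame_hom_bot: "frame_hom f \<Longrightarrow> f \<bottom> = \<bottom>"
  using frame_hom_Sup[of f "{}"] by simp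

lemma frame_hom_sup: "frame_hom f \<Longrightarrow> f (a \<squnion> b) = f a \<squnion> f b"
  using frame_hom_Sup[of f "{a, b}"] by simp

lemma frame_hom_mono: "frame_hom f \<Longrightarrow> a \<le> b \<Longrightarrow> f a \<le> f b"
  by (metis frame_hom_inf inf.absorb_iff2 inf.commute)

text \<open>A frame homomorphism on a power set is determined by its values on points, which are pairwise
  disjoint with join \<open>\<top>\<close>.\<close>

lemma frame_hom_atoms: "frame_hom f \<Longrightarrow> f X = (\<Squnion>x\<in>X. f {x})"
  using frame_hom_Sup[of f "(\<lambda>x. {x}) ` X"] by (simp add: image_image)

definition pushforward :: "('x \<Rightarrow> 'y) \<Rightarrow> ('x set \<Rightarrow> 'a) \<Rightarrow> 'y set \<Rightarrow> 'a" where
  "pushforward u J X = J (u -` X)"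

lemma frame_hom_pushforward:
  assumes "frame_hom J"
  shows "frame_hom (pushforward u J)"
proof -
  have "J (\<Union>X\<in>S. u -` X) = (\<Squnion>X\<in>S. J (u -` X))" for S
    using frame_hom_Sup[OF assms, of "(\<lambda>X. u -` X) ` S"] by (simp add: image_image)
  then show ?thesis
    using assms by (simp add: frame_hom_def pushforward_def vimage_Union)
qed

text \<open>The common refinement of two partitions, indexed by pairs of points: the coproduct pairing of
  the frame homomorphisms \<open>f\<close> and \<open>g\<close>, and the analogue of the joint law of independent variables
  with products of probabilities replaced by meets.\<close>

definition joint :: "('x set \<Rightarrow> 'a::frame) \<Rightarrow> ('y set \<Rightarrow> 'a) \<Rightarrow> ('x \<times> 'y) set \<Rightarrow> 'a" where
  "joint f g W = (\<Squnion>(x, y)\<in>W. f {x} \<sqinter> g {y})"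

lemma joint_Times:
  assumes f: "frame_hom f" and g: "frame_hom g"
  shows "joint f g (X \<times> Y) = f X \<sqinter> g Y"
proof -
  have "f X \<sqinter> g Y = (\<Squnion>x\<in>X. \<Squnion>y\<in>Y. f {x} \<sqinter> g {y})"
    unfolding frame_hom_atoms[OF f, of X] frame_hom_atoms[OF g, of Y]
    by (simp add: SUP_inf_frame inf_SUP_frame) (rule SUP_commute)
  also have "\<dots> = joint f g (X \<times> Y)"
    unfolding joint_def by (intro antisym SUP_least) (auto intro: SUP_upper2)
  finally show ?thesis ..
qed

lemma frame_hom_joint:
  assumes f: "frame_hom f" and g: "frame_hom g"
  shows "frame_hom (joint f g)"
proof -
  have top: "joint f g \<top> = \<top>"
    using joint_Times[OF f g, of UNIV UNIV] frame_hom_top[OF f] frame_hom_top[OF g] by simp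
  have Sup: "joint f g (\<Squnion>S) = (\<Squnion>W\<in>S. joint f g W)" for S
    unfolding joint_def by (intro antisym SUP_least) (auto intro!: SUP_upper2)
  have mono: "joint f g V \<le> joint f g W" if "V \<subseteq> W" for V W
    using that unfolding joint_def by (rule SUP_subset_mono) simp
  have "joint f g V \<sqinter> joint f g W \<le> joint f g (V \<sqinter> W)" for V W
  proof -
    have "f {x} \<sqinter> g {y} \<sqinter> (f {x'} \<sqinter> g {y'}) \<le> joint f g (V \<sqinter> W)"
      if "(x, y) \<in> V" "(x', y') \<in> W" for x y x' y'
    proof (cases "x = x' \<and> y = y'")
      \<comment> \<open>Cells over distinct pairs of points are disjoint, so only the diagonal terms survive.\<close>
      case True
      then show ?thesis
        using that unfolding joint_def by (auto intro!: SUP_upper2[of "(x, y)"])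
    next
      case False
      then have "f ({x} \<inter> {x'}) \<sqinter> g ({y} \<inter> {y'}) = \<bottom>"
        using frame_hom_bot[OF f] frame_hom_bot[OF g] by auto
      then have "f {x} \<sqinter> g {y} \<sqinter> (f {x'} \<sqinter> g {y'}) = \<bottom>"
        by (simp add: frame_hom_inf[OF f] frame_hom_inf[OF g] ac_simps)
      then show ?thesis
        by simp
    qed
    then show ?thesis
      unfolding joint_def[of f g V] joint_def[of f g W] SUP_inf_frame inf_SUP_frame
      by (auto intro!: SUP_least)
  qed
  moreover have "joint f g (V \<sqinter> W) \<le> joint f g V \<sqinter> joint f g W" for V W
    using mono[of "V \<sqinter> W" V] mono[of "V \<sqinter> W" W] by simp
  ultimately show ?thesis
    using top Sup by (simp add: frame_hom_def antisym)
qed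

lemma pushforward_joint:
  fixes f :: "'x set \<Rightarrow> 'a::frame" and g :: "'y set \<Rightarrow> 'a"
  assumes f: "frame_hom f" and g: "frame_hom g"
  shows "pushforward fst (joint f g) = f" and "pushforward snd (joint f g) = g"
proof -
  have rectangle: "fst -` X = X \<times> (UNIV :: 'y set)" "snd -` Y = (UNIV :: 'x set) \<times> Y" for X Y
    by auto
  show "pushforward fst (joint f g) = f" "pushforward snd (joint f g) = g"
    using frame_hom_top[OF f] frame_hom_top[OF g]
    unfolding fun_eq_iff pushforward_def rectangle joint_Times[OF f g] by simp_all
qed

lemma pushforward_pushforward: "pushforward v (pushforward u J) = pushforward (v \<circ> u) J"
  by (simp add: pushforward_def fun_eq_iff vimage_comp)

text \<open>Once two functions are images of one partition \<open>J\<close>, the join defining \<open>rc_op\<close> collapses: each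
  term is \<open>J\<close> of a set contained in the preimage of \<open>X\<close>, and the points of that preimage are reached by
  singletons \<open>Y\<close> and \<open>Z\<close>. Every algebraic identity below is an instance of this pointwise rule.\<close>

lemma rc_op_pushforward:
  assumes J: "frame_hom J"
  shows "rc_op h (pushforward u J) (pushforward v J) = pushforward (\<lambda>w. h (u w) (v w)) J"
proof
  fix X
  let ?H = "(\<lambda>w. h (u w) (v w)) -` X"
  have "J (u -` Y) \<sqinter> J (v -` Z) \<le> J ?H"
    if "{h y z |y z. y \<in> Y \<and> z \<in> Z} \<subseteq> X" for Y Z
  proof -
    have "(u -` Y) \<inter> (v -` Z) \<subseteq> ?H"
      using that by auto
    then show ?thesis
      using frame_hom_mono[OF J] frame_hom_inf[OF J] by metis
  qed
  then have le: "rc_op h (pushforward u J) (pushforward v J) X \<le> J ?H"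
    unfolding rc_op_def pushforward_def by (auto intro!: Sup_least)
  have "J {w} \<le> rc_op h (pushforward u J) (pushforward v J) X" if "w \<in> ?H" for w
  proof -
    have "J {w} \<le> J (u -` {u w}) \<sqinter> J (v -` {v w})"
      by (auto intro!: frame_hom_mono[OF J])
    also have "\<dots> \<le> rc_op h (pushforward u J) (pushforward v J) X"
      unfolding rc_op_def pushforward_def
      by (rule Sup_upper) (use that in auto)
    finally show ?thesis .
  qed
  then have "J ?H \<le> rc_op h (pushforward u J) (pushforward v J) X"
    by (subst frame_hom_atoms[OF J]) (rule SUP_least)
  then show "rc_op h (pushforward u J) (pushforward v J) X = pushforward (\<lambda>w. h (u w) (v w)) J X"
    using le by (simp add: pushforward_def antisym)
qed

lemma rc_const_pushforward: "frame_hom J \<Longrightarrow> rc_const r = pushforward (\<lambda>_. r) J"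
  using frame_hom_top[of J] frame_hom_bot[of J]
  by (auto simp: fun_eq_iff rc_const_def pushforward_def)

lemma rc_op_eq_pushforward_joint:
  assumes "frame_hom f" "frame_hom g"
  shows "rc_op h f g = pushforward (\<lambda>(x, y). h x y) (joint f g)"
  using rc_op_pushforward[OF frame_hom_joint[OF assms], of h fst snd] pushforward_joint[OF assms]
  by (simp add: case_prod_beta')

lemma common_refinement3:
  fixes f :: "'x set \<Rightarrow> 'a::frame" and g :: "'y set \<Rightarrow> 'a" and k :: "'z set \<Rightarrow> 'a"
  assumes f: "frame_hom f" and g: "frame_hom g" and k: "frame_hom k"
  obtains J :: "('x \<times> 'y \<times> 'z) set \<Rightarrow> 'a" and u v w
  where "frame_hom J" "f = pushforward u J" "g = pushforward v J" "k = pushforward w J"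
proof -
  let ?J = "joint f (joint g k)"
  note gk = frame_hom_joint[OF g k]
  have f': "f = pushforward fst ?J"
    by (simp add: pushforward_joint[OF f gk])
  have g': "g = pushforward (fst \<circ> snd) ?J" and k': "k = pushforward (snd \<circ> snd) ?J"
    by (simp_all only: pushforward_pushforward[symmetric] pushforward_joint[OF f gk] pushforward_joint[OF g k])
  show thesis
    by (rule that[OF frame_hom_joint[OF f gk] f' g' k'])
qed

section \<open>Continuity\<close>

lemma subframe_SUP:
  assumes "subframe \<tau>" and "\<And>i. i \<in> I \<Longrightarrow> g i \<in> \<tau>"
  shows "(\<Squnion>i\<in>I. g i) \<in> \<tau>"
proof -
  have "g ` I \<subseteq> \<tau>"
    using assms(2) by blast
  then show ?thesis
    using assms(1) unfolding subframe_def by blast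
qed

lemma subframe_bot: "subframe \<tau> \<Longrightarrow> \<bottom> \<in> \<tau>"
  using subframe_SUP[of \<tau> "{}"] by simp

lemma subframe_top: "subframe \<tau> \<Longrightarrow> \<top> \<in> \<tau>"
  by (simp add: subframe_def)

text \<open>Real-continuity for homomorphisms on the power set of any topological space, with all open sets
  in place of rational intervals; the refinement \<open>joint f g\<close> lives on the plane.\<close>

definition open_hom :: "'a::frame set \<Rightarrow> ('x::topological_space set \<Rightarrow> 'a) \<Rightarrow> bool" where
  "open_hom \<tau> f \<longleftrightarrow> frame_hom f \<and> (\<forall>U. open U \<longrightarrow> f U \<in> \<tau>)"

lemma open_hom_pushforward:
  assumes "open_hom \<tau> J" and "continuous_on UNIV u"
  shows "open_hom \<tau> (pushforward u J)"
  using assms open_vimage[OF _ assms(2)]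
  unfolding open_hom_def by (simp add: frame_hom_pushforward) (simp add: pushforward_def)

text \<open>An open set of the product is a union of open rectangles, and \<open>joint f g\<close> sends a rectangle to
  a meet of two members of \<open>\<tau>\<close>.\<close>

lemma open_hom_joint:
  assumes \<tau>: "subframe \<tau>" and f: "open_hom \<tau> f" and g: "open_hom \<tau> g"
  shows "open_hom \<tau> (joint f g)"
proof -
  have hom: "frame_hom f" "frame_hom g"
    using f g by (auto simp: open_hom_def)
  note J = frame_hom_joint[OF hom]
  have "joint f g W \<in> \<tau>" if "open W" for W
  proof -
    let ?B = "{A \<times> B |A B. open A \<and> open B \<and> A \<times> B \<subseteq> W}"
    have "W = \<Union>?B"
    proof
      show "W \<subseteq> \<Union>?B"
      proof
        fix w assume "w \<in> W"
        with that obtain A B where "open A" "open B" "w \<in> A \<times> B" "A \<times> B \<subseteq> W"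
          by (rule open_prod_elim)
        then show "w \<in> \<Union>?B"
          by blast
      qed
    qed blast
    then have eq: "joint f g W = (\<Squnion>V\<in>?B. joint f g V)"
      using frame_hom_Sup[OF J, of ?B] by simp
    have "joint f g V \<in> \<tau>" if "V \<in> ?B" for V
      using that f g \<tau> by (auto simp: joint_Times[OF hom] open_hom_def subframe_def)
    then show ?thesis
      unfolding eq by (rule subframe_SUP[OF \<tau>])
  qed
  then show ?thesis
    using J by (simp add: open_hom_def)
qed

lemma real_continuous_iff_open_hom:
  assumes \<tau>: "subframe \<tau>"
  shows "real_continuous \<tau> f \<longleftrightarrow> open_hom \<tau> f"
proof
  assume rc: "real_continuous \<tau> f"
  then have f: "frame_hom f"
    by (simp add: real_continuous_def)
  have "f U \<in> \<tau>" if U: "open U" for U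
  proof -
    let ?B = "{{x. of_rat p < x \<and> x < of_rat q} |p q. {x::real. of_rat p < x \<and> x < of_rat q} \<subseteq> U}"
    have "U = \<Union>?B"
    proof
      show "U \<subseteq> \<Union>?B"
      proof
        fix x assume "x \<in> U"
        then obtain e where e: "e > 0" "\<And>y. \<bar>y - x\<bar> < e \<Longrightarrow> y \<in> U"
          using U unfolding open_dist dist_real_def by blast
        obtain p where p: "x - e < of_rat p" "of_rat p < x"
          using of_rat_dense[of "x - e" x] e(1) by auto
        obtain q where q: "x < of_rat q" "of_rat q < x + e"
          using of_rat_dense[of x "x + e"] e(1) by auto
        have "{y. of_rat p < y \<and> y < of_rat q} \<subseteq> U"
          using p q by (auto intro!: e(2))
        then show "x \<in> \<Union>?B"
          using p q by blast
      qed
    qed blast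
    then have eq: "f U = (\<Squnion>V\<in>?B. f V)"
      using frame_hom_Sup[OF f, of ?B] by simp
    have "f V \<in> \<tau>" if "V \<in> ?B" for V
      using that rc by (auto simp: real_continuous_def)
    then show ?thesis
      unfolding eq by (rule subframe_SUP[OF \<tau>])
  qed
  then show "open_hom \<tau> f"
    using f by (simp add: open_hom_def)
next
  assume f: "open_hom \<tau> f"
  have "open {x::real. of_rat p < x \<and> x < of_rat q}" for p q
    by (intro open_Collect_conj open_Collect_less continuous_intros)
  then show "real_continuous \<tau> f"
    using f by (simp add: real_continuous_def open_hom_def)
qed

lemma real_continuous_rc_op:
  assumes \<tau>: "subframe \<tau>" and "real_continuous \<tau> f" "real_continuous \<tau> g"
    and h: "continuous_on UNIV (\<lambda>(x, y). h x y)"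
  shows "real_continuous \<tau> (rc_op h f g)"
proof -
  have fg: "open_hom \<tau> f" "open_hom \<tau> g"
    using assms by (simp_all add: real_continuous_iff_open_hom)
  then have "rc_op h f g = pushforward (\<lambda>(x, y). h x y) (joint f g)"
    by (intro rc_op_eq_pushforward_joint) (simp_all add: open_hom_def)
  then show ?thesis
    using open_hom_pushforward[OF open_hom_joint[OF \<tau> fg] h] \<tau>
    by (simp add: real_continuous_iff_open_hom)
qed

text \<open>Membership of a fixed point is a join-preserving function of the set; this is why functions
  concentrated on one or two points are frame homomorphisms.\<close>

lemma if_mem_Union:
  "(if t \<in> \<Union>S then c else \<bottom>) = (\<Squnion>X\<in>S. if t \<in> X then c else (\<bottom>::'a::complete_lattice))"
proof (rule antisym)
  show "(if t \<in> \<Union>S then c else \<bottom>) \<le> (\<Squnion>X\<in>S. if t \<in> X then c else \<bottom>)"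
  proof (cases "t \<in> \<Union>S")
    case True
    then obtain X where "X \<in> S" "t \<in> X"
      by blast
    then show ?thesis
      by (intro SUP_upper2[of X]) auto
  qed simp
  show "(\<Squnion>X\<in>S. if t \<in> X then c else \<bottom>) \<le> (if t \<in> \<Union>S then c else \<bottom>)"
    by (rule SUP_least) auto
qed

lemma real_continuous_rc_const:
  fixes \<tau> :: "'a::frame set"
  assumes "subframe \<tau>"
  shows "real_continuous \<tau> (rc_const r)"
proof -
  have "rc_const r (\<Union>S) = (\<Squnion>X\<in>S. rc_const r X :: 'a)" for S
    unfolding rc_const_def by (rule if_mem_Union)
  then have "frame_hom (rc_const r :: _ \<Rightarrow> 'a)"
    by (auto simp: frame_hom_def rc_const_def)
  then show ?thesis
    using subframe_bot[OF assms] subframe_top[OF assms]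
    by (auto simp: real_continuous_def rc_const_def)
qed

section \<open>The ring of real-continuous functions\<close>

lemma RL_simps:
  "carrier (RL \<tau>) = {f. real_continuous \<tau> f}"
  "f \<otimes>\<^bsub>RL \<tau>\<^esub> g = rc_op (*) f g"
  "f \<oplus>\<^bsub>RL \<tau>\<^esub> g = rc_op (+) f g"
  "\<one>\<^bsub>RL \<tau>\<^esub> = rc_const 1"
  "\<zero>\<^bsub>RL \<tau>\<^esub> = rc_const 0"
  by (simp_all add: RL_def)

lemma real_continuous_hom: "real_continuous \<tau> f \<Longrightarrow> frame_hom f"
  by (simp add: real_continuous_def)

lemma rc_op_assoc:
  assumes "frame_hom f" "frame_hom g" "frame_hom k" and "\<And>x y z. h (h x y) z = h x (h y z)"
  shows "rc_op h (rc_op h f g) k = rc_op h f (rc_op h g k)"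
  by (rule common_refinement3[OF assms(1-3)]) (simp add: rc_op_pushforward assms(4))

text \<open>For identities in two variables the refinement of three functions is used with one of them
  repeated.\<close>

lemma rc_op_commute:
  assumes "frame_hom f" "frame_hom g" and "\<And>x y. h x y = h y x"
  shows "rc_op h f g = rc_op h g f"
  by (rule common_refinement3[OF assms(1,2,2)]) (simp add: rc_op_pushforward assms(3))

lemma rc_op_distrib:
  assumes "frame_hom f" "frame_hom g" "frame_hom k"
    and "\<And>x y z. m (p x y) z = p (m x z) (m y z)"
  shows "rc_op m (rc_op p f g) k = rc_op p (rc_op m f k) (rc_op m g k)"
  by (rule common_refinement3[OF assms(1-3)]) (simp add: rc_op_pushforward assms(4))

lemma pushforward_id: "pushforward (\<lambda>x. x) f = f"
  by (simp add: pushforward_def fun_eq_iff vimage_def)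

lemma rc_op_neutral:
  assumes f: "frame_hom f" and "\<And>x. h r x = x"
  shows "rc_op h (rc_const r) f = f"
  using rc_op_pushforward[OF f, of h "\<lambda>_. r" "\<lambda>x. x"] assms(2)
  by (simp add: rc_const_pushforward[OF f, symmetric] pushforward_id)

lemma cring_RL:
  assumes \<tau>: "subframe \<tau>"
  shows "cring (RL \<tau>)"
proof (rule cringI)
  note hom = real_continuous_hom
  have add: "real_continuous \<tau> (rc_op (+) f g)"
    and mult: "real_continuous \<tau> (rc_op (*) f g)"
    if "real_continuous \<tau> f" "real_continuous \<tau> g" for f g
    using \<tau> that by (auto intro!: real_continuous_rc_op continuous_intros simp: case_prod_beta')
  show "abelian_group (RL \<tau>)"
  proof (rule abelian_groupI; simp only: RL_simps mem_Collect_eq)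
    fix f assume f: "real_continuous \<tau> f"
    let ?g = "pushforward uminus f"
    have "real_continuous \<tau> ?g"
      using f \<tau> by (auto simp: real_continuous_iff_open_hom intro!: open_hom_pushforward continuous_intros)
    moreover have "rc_op (+) ?g f = rc_const 0"
      using rc_op_pushforward[OF hom[OF f], of "(+)" uminus "\<lambda>x. x"]
      by (simp add: pushforward_id rc_const_pushforward[OF hom[OF f]])
    ultimately show "\<exists>g\<in>{g. real_continuous \<tau> g}. rc_op (+) g f = rc_const 0"
      by blast
  qed (simp_all add: add real_continuous_rc_const[OF \<tau>] rc_op_assoc rc_op_commute[of _ _ "(+)"]
      rc_op_neutral hom ac_simps)
  show "comm_monoid (RL \<tau>)"
    by (rule comm_monoidI; simp only: RL_simps mem_Collect_eq)
      (simp_all add: mult real_continuous_rc_const[OF \<tau>] rc_op_assoc rc_op_commute[of _ _ "(*)"]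
        rc_op_neutral hom ac_simps)
qed (simp add: RL_simps rc_op_distrib real_continuous_hom distrib_right)

section \<open>Cozero elements\<close>

lemma coz_pushforward: "coz (pushforward u J) = J {w. u w \<noteq> 0}"
  by (simp add: coz_def pushforward_def vimage_def Compl_eq_Diff_UNIV[symmetric] Collect_neg_eq[symmetric])

lemma coz_mult:
  assumes "frame_hom f" "frame_hom g"
  shows "coz (rc_op (*) f g) = coz f \<sqinter> coz g"
proof (rule common_refinement3[OF assms(1,2,2)])
  fix J :: "(real \<times> real \<times> real) set \<Rightarrow> 'a" and u v w
  assume J: "frame_hom J" and f: "f = pushforward u J" and g: "g = pushforward v J"
  have "{w. u w * v w \<noteq> 0} = {w. u w \<noteq> 0} \<inter> {w. v w \<noteq> 0}"
    by auto
  then show ?thesis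
    by (simp add: f g rc_op_pushforward[OF J] coz_pushforward frame_hom_inf[OF J])
qed

lemma coz_add_le:
  assumes "frame_hom f" "frame_hom g"
  shows "coz (rc_op (+) f g) \<le> coz f \<squnion> coz g"
proof (rule common_refinement3[OF assms(1,2,2)])
  fix J :: "(real \<times> real \<times> real) set \<Rightarrow> 'a" and u v w
  assume J: "frame_hom J" and f: "f = pushforward u J" and g: "g = pushforward v J"
  have "{w. u w + v w \<noteq> 0} \<subseteq> {w. u w \<noteq> 0} \<union> {w. v w \<noteq> 0}"
    by auto
  then show ?thesis
    using frame_hom_mono[OF J]
    by (simp add: f g rc_op_pushforward[OF J] coz_pushforward frame_hom_sup[OF J, symmetric])
qed

lemma coz_const: "coz (rc_const 0) = \<bottom>" "coz (rc_const 1) = \<top>"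
  by (simp_all add: coz_def rc_const_def)

text \<open>If \<open>coz f = \<bottom>\<close>, the whole of \<open>\<top>\<close> is concentrated on the point \<open>0\<close>.\<close>

lemma coz_eq_bot_iff:
  assumes f: "frame_hom f"
  shows "coz f = \<bottom> \<longleftrightarrow> f = rc_const 0"
proof
  assume coz: "coz f = \<bottom>"
  have "f {0} \<squnion> coz f = f UNIV"
    using frame_hom_sup[OF f, of "{0}" "UNIV - {0}"] by (simp add: coz_def)
  then have zero: "f {0} = \<top>"
    using coz frame_hom_top[OF f] by simp
  show "f = rc_const 0"
  proof
    fix X
    show "f X = rc_const 0 X"
    proof (cases "0 \<in> X")
      case True
      then show ?thesis
        using zero frame_hom_mono[OF f, of "{0}" X] by (simp add: rc_const_def top_unique)
    next
      case False
      then show ?thesis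
        using coz frame_hom_mono[OF f, of X "UNIV - {0}"]
        by (auto simp: rc_const_def coz_def bot_unique)
    qed
  qed
qed (simp add: coz_const)

lemma coz_mem:
  assumes "subframe \<tau>" "real_continuous \<tau> f"
  shows "coz f \<in> \<tau>"
  using assms by (simp add: real_continuous_iff_open_hom open_hom_def coz_def open_Diff)

text \<open>The characteristic function of \<open>a\<close>, with value \<open>1\<close> on \<open>a\<close> and \<open>0\<close> on its complement \<open>b\<close>.\<close>

definition two_valued :: "'a::frame \<Rightarrow> 'a \<Rightarrow> real set \<Rightarrow> 'a" where
  "two_valued a b X = (if 1 \<in> X then a else \<bottom>) \<squnion> (if 0 \<in> X then b else \<bottom>)"

lemma frame_hom_two_valued:
  assumes ab: "is_complement a b"
  shows "frame_hom (two_valued a b)"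
proof -
  have ab: "a \<sqinter> b = \<bottom>" "a \<squnion> b = \<top>"
    using ab by (auto simp: is_complement_def)
  have dist: "(x \<squnion> y) \<sqinter> (z \<squnion> w) = (x \<sqinter> z \<squnion> y \<sqinter> z) \<squnion> (x \<sqinter> w \<squnion> y \<sqinter> w)" for x y z w :: 'a
    by (simp add: inf_sup_frame inf_commute)
  have "two_valued a b (\<Union>S) = (\<Squnion>X\<in>S. two_valued a b X)" for S
    unfolding two_valued_def if_mem_Union by (rule complete_lattice_class.SUP_sup_distrib)
  then show ?thesis
    using ab by (auto simp: frame_hom_def two_valued_def dist inf_commute sup_commute)
qed

lemma real_continuous_two_valued:
  assumes \<tau>: "subframe \<tau>" and ab: "is_complement a b" and "a \<in> \<tau>" "b \<in> \<tau>"
  shows "real_continuous \<tau> (two_valued a b)"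
proof -
  have "a \<squnion> b = \<top>"
    using ab by (simp add: is_complement_def)
  then have "two_valued a b X \<in> \<tau>" for X
    using assms subframe_bot[OF \<tau>] subframe_top[OF \<tau>] by (simp add: two_valued_def)
  then show ?thesis
    using frame_hom_two_valued[OF ab] by (simp add: real_continuous_def)
qed

lemma idempotent_two_valued:
  assumes "subframe \<tau>" "is_complement a b" "a \<in> \<tau>" "b \<in> \<tau>"
  shows "idempotent_elem (RL \<tau>) (two_valued a b)"
proof -
  note e = frame_hom_two_valued[OF assms(2)]
  have "rc_op (*) (two_valued a b) (two_valued a b) = pushforward (\<lambda>x. x * x) (two_valued a b)"
    using rc_op_pushforward[OF e, of "(*)" "\<lambda>x. x" "\<lambda>x. x"] by (simp add: pushforward_id)
  also have "\<dots> = two_valued a b"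
    by (simp add: fun_eq_iff pushforward_def two_valued_def)
  finally show ?thesis
    using real_continuous_two_valued[OF assms] by (simp add: idempotent_elem_def RL_simps)
qed

lemma coz_two_valued: "coz (two_valued a b) = a"
  by (simp add: coz_def two_valued_def)

lemma reduced_cring_RL:
  assumes "subframe \<tau>"
  shows "reduced_cring (RL \<tau>)"
proof (rule reduced_cring.intro[OF cring_RL[OF assms]], rule reduced_cring_axioms.intro)
  fix f assume "f \<in> carrier (RL \<tau>)" and "f \<otimes>\<^bsub>RL \<tau>\<^esub> f = \<zero>\<^bsub>RL \<tau>\<^esub>"
  then have f: "frame_hom f" and "rc_op (*) f f = rc_const 0"
    by (auto simp: RL_simps real_continuous_hom)
  then have "coz f = \<bottom>"
    using coz_mult[OF f f] by (simp add: coz_const)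
  then show "f = \<zero>\<^bsub>RL \<tau>\<^esub>"
    using f by (simp add: coz_eq_bot_iff RL_simps)
qed

lemma mult_eq_zero_iff_coz:
  assumes \<tau>: "subframe \<tau>" and "f \<in> carrier (RL \<tau>)" "g \<in> carrier (RL \<tau>)"
  shows "f \<otimes>\<^bsub>RL \<tau>\<^esub> g = \<zero>\<^bsub>RL \<tau>\<^esub> \<longleftrightarrow> coz f \<sqinter> coz g = \<bottom>"
proof -
  interpret cring "RL \<tau>"
    using \<tau> by (rule cring_RL)
  have hom: "frame_hom f" "frame_hom g" "frame_hom (f \<otimes>\<^bsub>RL \<tau>\<^esub> g)"
    using assms m_closed[OF assms(2,3)] by (auto simp: RL_simps(1) real_continuous_hom)
  show ?thesis
    using coz_eq_bot_iff[OF hom(3)] coz_mult[OF hom(1,2)] by (simp add: RL_simps)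
qed

text \<open>Disjointness comes from \<open>e(1 - e) = 0\<close> and covering from \<open>e + (1 - e) = 1\<close>. As both cozero elements belong to \<open>\<tau>\<close>, so does the complement
  of \<open>coz e\<close>.\<close>

lemma idempotent_coz_complement:
  assumes \<tau>: "subframe \<tau>" and e: "idempotent_elem (RL \<tau>) e"
  shows "is_complement (coz e) (coz (\<one>\<^bsub>RL \<tau>\<^esub> \<ominus>\<^bsub>RL \<tau>\<^esub> e))"
proof -
  interpret cring "RL \<tau>"
    using \<tau> by (rule cring_RL)
  let ?f = "\<one>\<^bsub>RL \<tau>\<^esub> \<ominus>\<^bsub>RL \<tau>\<^esub> e"
  have carr: "e \<in> carrier (RL \<tau>)" "?f \<in> carrier (RL \<tau>)"
    using e by (auto simp: idempotent_elem_def)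
  have "e \<oplus>\<^bsub>RL \<tau>\<^esub> ?f = \<one>\<^bsub>RL \<tau>\<^esub>"
    using carr by (simp add: add_one_minus)
  then have "rc_op (+) e ?f = rc_const 1"
    by (simp only: RL_simps(3,4))
  then have "coz (rc_op (+) e ?f) = \<top>"
    by (simp only: coz_const(2))
  then have "coz e \<squnion> coz ?f = \<top>"
    using coz_add_le[of e ?f] carr by (simp add: RL_simps(1) real_continuous_hom top_unique)
  then show ?thesis
    using mult_eq_zero_iff_coz[OF \<tau> carr] idempotent_complement(2)[OF e]
    by (simp add: is_complement_def)
qed

lemma mem_PIdl_idempotent_iff_coz:
  assumes \<tau>: "subframe \<tau>" and e: "idempotent_elem (RL \<tau>) e"
  shows "f \<in> PIdl\<^bsub>RL \<tau>\<^esub> e \<longleftrightarrow> f \<in> carrier (RL \<tau>) \<and> coz f \<le> coz e"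
proof -
  interpret cring "RL \<tau>"
    using \<tau> by (rule cring_RL)
  let ?f = "\<one>\<^bsub>RL \<tau>\<^esub> \<ominus>\<^bsub>RL \<tau>\<^esub> e"
  have "?f \<in> carrier (RL \<tau>)"
    using e by (auto simp: idempotent_elem_def)
  then show ?thesis
    unfolding mem_PIdl_idempotent_iff_annihilates[OF e]
    using mult_eq_zero_iff_coz[OF \<tau>]
      inf_le_bot_iff_le_complement[OF is_complement_sym[OF idempotent_coz_complement[OF \<tau> e]]]
    by blast
qed

section \<open>Exteriors and extremal disconnectedness\<close>

text \<open>The pseudocomplement of \<open>a\<close> computed inside the frame \<open>\<tau>\<close>.\<close>

definition tf_exterior :: "'a::frame set \<Rightarrow> 'a \<Rightarrow> 'a" where
  "tf_exterior \<tau> a = \<Squnion>{t \<in> \<tau>. t \<sqinter> a = \<bottom>}"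

lemma tf_exterior_mem: "subframe \<tau> \<Longrightarrow> tf_exterior \<tau> a \<in> \<tau>"
  using subframe_SUP[of \<tau> "{t \<in> \<tau>. t \<sqinter> a = \<bottom>}" "\<lambda>t. t"] by (simp add: tf_exterior_def)

lemma le_tf_exterior_iff:
  assumes "t \<in> \<tau>"
  shows "t \<le> tf_exterior \<tau> a \<longleftrightarrow> t \<sqinter> a = \<bottom>"
proof
  have "tf_exterior \<tau> a \<sqinter> a = (\<Squnion>t\<in>{t \<in> \<tau>. t \<sqinter> a = \<bottom>}. t \<sqinter> a)"
    using inf_Sup_frame[of a "{t \<in> \<tau>. t \<sqinter> a = \<bottom>}"] by (simp add: tf_exterior_def inf_commute)
  also have "\<dots> = \<bottom>"
    by (auto intro!: antisym SUP_least)
  finally have ext: "tf_exterior \<tau> a \<sqinter> a = \<bottom>" .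
  show "t \<sqinter> a = \<bottom>" if "t \<le> tf_exterior \<tau> a"
    using inf_mono[OF that order_refl[of a]] ext by (simp add: bot_unique)
  show "t \<le> tf_exterior \<tau> a" if "t \<sqinter> a = \<bottom>"
    unfolding tf_exterior_def by (rule Sup_upper) (use that assms in simp)
qed

text \<open>For \<open>t\<close> in \<open>\<tau>\<close>, the complement of \<open>t\<close> lies above \<open>a\<close> iff \<open>t\<close> lies below the exterior of \<open>a\<close>.
  Complements reverse the order, so the least such complement belongs to the exterior itself.\<close>

lemma is_complement_exterior_closure:
  assumes "topoframe \<tau>"
  shows "is_complement (tf_exterior \<tau> a) (tf_closure \<tau> a)"
proof -
  interpret topoframe \<tau> by fact
  let ?x = "tf_exterior \<tau> a"
  have compl: "is_complement t (frame_compl t)" if "t \<in> \<tau>" for t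
    using that complemented_tau is_complement_frame_compl by blast
  have x: "?x \<in> \<tau>"
    using subframe_tau by (rule tf_exterior_mem)
  have above: "a \<le> frame_compl t \<longleftrightarrow> t \<le> ?x" if "t \<in> \<tau>" for t
    using inf_le_bot_iff_le_complement[OF compl[OF that], of a] le_tf_exterior_iff[OF that, of a]
    by (simp add: inf_commute)
  have "tf_closure \<tau> a = frame_compl ?x"
    unfolding tf_closure_def
  proof (rule antisym)
    show "\<Sqinter>{y \<in> frame_compl ` \<tau>. a \<le> y} \<le> frame_compl ?x"
      by (rule Inf_lower) (use x above in auto)
    show "frame_compl ?x \<le> \<Sqinter>{y \<in> frame_compl ` \<tau>. a \<le> y}"
    proof (rule Inf_greatest)
      fix y assume "y \<in> {y \<in> frame_compl ` \<tau>. a \<le> y}"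
      then obtain t where t: "t \<in> \<tau>" "y = frame_compl t" "t \<le> ?x"
        using above by auto
      have "frame_compl ?x \<sqinter> t \<le> ?x \<sqinter> frame_compl ?x"
        using t(3) by (simp add: le_infI2)
      then have "frame_compl ?x \<sqinter> t = \<bottom>"
        using compl[OF x] unfolding is_complement_def by (metis bot_unique)
      then show "frame_compl ?x \<le> y"
        using inf_le_bot_iff_le_complement[OF compl[OF t(1)]] t(2) by simp
    qed
  qed
  then show ?thesis
    using compl[OF x] by simp
qed

text \<open>By the frame law, \<open>coz f\<close> is disjoint from every \<open>coz s\<close> iff it is disjoint from their join.\<close>

lemma annihilator_RL:
  assumes \<tau>: "subframe \<tau>" and S: "S \<subseteq> carrier (RL \<tau>)"
  shows "annihilator (RL \<tau>) S = {f \<in> carrier (RL \<tau>). coz f \<le> tf_exterior \<tau> (\<Squnion>(coz ` S))}"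
proof -
  have "(\<forall>s\<in>S. f \<otimes>\<^bsub>RL \<tau>\<^esub> s = \<zero>\<^bsub>RL \<tau>\<^esub>) \<longleftrightarrow> coz f \<le> tf_exterior \<tau> (\<Squnion>(coz ` S))"
    if f: "f \<in> carrier (RL \<tau>)" for f
  proof -
    have "coz f \<in> \<tau>"
      using f by (intro coz_mem[OF \<tau>]) (simp add: RL_simps)
    then have "coz f \<le> tf_exterior \<tau> (\<Squnion>(coz ` S)) \<longleftrightarrow> (\<Squnion>s\<in>S. coz f \<sqinter> coz s) = \<bottom>"
      by (simp add: le_tf_exterior_iff inf_SUP_frame)
    also have "\<dots> \<longleftrightarrow> (\<forall>s\<in>S. coz f \<sqinter> coz s = \<bottom>)"
      by (simp add: SUP_bot_conv)
    also have "\<dots> \<longleftrightarrow> (\<forall>s\<in>S. f \<otimes>\<^bsub>RL \<tau>\<^esub> s = \<zero>\<^bsub>RL \<tau>\<^esub>)"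
      using mult_eq_zero_iff_coz[OF \<tau> f] S by blast
    finally show ?thesis ..
  qed
  then show ?thesis
    unfolding annihilator_def by blast
qed

lemma completely_regular_leI:
  assumes "completely_regular \<tau>" and "t \<in> \<tau>"
    and below: "\<And>f. \<lbrakk>f \<in> carrier (RL \<tau>); coz f \<le> t\<rbrakk> \<Longrightarrow> coz f \<le> a"
  shows "t \<le> a"
proof -
  obtain F where F: "F \<subseteq> carrier (RL \<tau>)" "t = \<Squnion>(coz ` F)"
    using assms(1,2) unfolding completely_regular_def by blast
  have "coz f \<le> a" if "f \<in> F" for f
  proof (rule below)
    show "f \<in> carrier (RL \<tau>)"
      using F(1) that by blast
    show "coz f \<le> t"
      unfolding F(2) using that by (rule SUP_upper)
  qed
  then show ?thesis
    unfolding F(2) by (rule SUP_least)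
qed

text \<open>In one direction the exterior of \<open>\<Squnion>(coz ` S)\<close> has its complement in \<open>\<tau>\<close>, and its characteristic
  function generates \<open>Ann S\<close>. In the other, write \<open>a = \<Squnion>(coz ` S)\<close>: the idempotent generating \<open>Ann S\<close>
  has the exterior of \<open>a\<close> as its cozero element, because both have the same cozero elements below
  them, and then the closure of \<open>a\<close> is \<open>coz (1 - e)\<close>.\<close>

lemma extremally_disconnected_iff_Baer:
  assumes "topoframe \<tau>" and cr: "completely_regular \<tau>"
  shows "extremally_disconnected \<tau> \<longleftrightarrow> Baer_ring (RL \<tau>)"
proof
  interpret topoframe \<tau> by fact
  note compl = is_complement_exterior_closure[OF assms(1)]
  {
    assume ed: "extremally_disconnected \<tau>"
    show "Baer_ring (RL \<tau>)"
      unfolding Baer_ring_def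
    proof (intro allI impI)
      fix S assume S: "S \<subseteq> carrier (RL \<tau>)"
      let ?s = "\<Squnion>(coz ` S)"
      let ?e = "two_valued (tf_exterior \<tau> ?s) (tf_closure \<tau> ?s)"
      have "?s \<in> \<tau>"
        using S by (intro subframe_SUP[OF subframe_tau] coz_mem[OF subframe_tau]) (auto simp: RL_simps)
      then have "tf_closure \<tau> ?s \<in> \<tau>"
        using ed unfolding extremally_disconnected_def by blast
      then have e: "idempotent_elem (RL \<tau>) ?e"
        by (intro idempotent_two_valued subframe_tau compl tf_exterior_mem)
      have "annihilator (RL \<tau>) S = PIdl\<^bsub>RL \<tau>\<^esub> ?e"
        using annihilator_RL[OF subframe_tau S] mem_PIdl_idempotent_iff_coz[OF subframe_tau e]
        by (auto simp: coz_two_valued)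
      then show "\<exists>e. idempotent_elem (RL \<tau>) e \<and> annihilator (RL \<tau>) S = PIdl\<^bsub>RL \<tau>\<^esub> e"
        using e by blast
    qed
  next
    assume baer: "Baer_ring (RL \<tau>)"
    show "extremally_disconnected \<tau>"
      unfolding extremally_disconnected_def
    proof
      fix a assume "a \<in> \<tau>"
      then obtain S where S: "S \<subseteq> carrier (RL \<tau>)" "a = \<Squnion>(coz ` S)"
        using cr unfolding completely_regular_def by blast
      obtain e where e: "idempotent_elem (RL \<tau>) e" "annihilator (RL \<tau>) S = PIdl\<^bsub>RL \<tau>\<^esub> e"
        using baer S(1) unfolding Baer_ring_def by blast
      interpret cring "RL \<tau>"
        using subframe_tau by (rule cring_RL)
      let ?f = "\<one>\<^bsub>RL \<tau>\<^esub> \<ominus>\<^bsub>RL \<tau>\<^esub> e"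
      have carr: "e \<in> carrier (RL \<tau>)" "?f \<in> carrier (RL \<tau>)"
        using e(1) by (auto simp: idempotent_elem_def)
      have same: "coz g \<le> tf_exterior \<tau> a \<longleftrightarrow> coz g \<le> coz e" if "g \<in> carrier (RL \<tau>)" for g
        using that e(2) annihilator_RL[OF subframe_tau S(1)]
          mem_PIdl_idempotent_iff_coz[OF subframe_tau e(1), of g]
        unfolding S(2) by blast
      have "tf_exterior \<tau> a \<le> coz e"
        by (rule completely_regular_leI[OF cr tf_exterior_mem[OF subframe_tau]]) (simp add: same)
      moreover have "coz e \<le> tf_exterior \<tau> a"
        using same[OF carr(1)] by simp
      ultimately have "coz e = tf_exterior \<tau> a"
        by (rule antisym[rotated])
      then have "tf_closure \<tau> a = coz ?f"
        using compl[of a] idempotent_coz_complement[OF subframe_tau e(1)]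
        by (simp add: frame_complement_unique)
      then show "tf_closure \<tau> a \<in> \<tau>"
        using carr(2) coz_mem[OF subframe_tau] by (simp add: RL_simps(1))
    qed
  }
qed

theorem proposition5:
  fixes \<tau> :: "'a::frame set"
  assumes "topoframe \<tau>" and "completely_regular \<tau>"
  shows "(extremally_disconnected \<tau> \<longleftrightarrow> Baer_ring (RL \<tau>)) \<and>
         (Baer_ring (RL \<tau>) \<longleftrightarrow>
            (\<forall>I. ideal I (RL \<tau>) \<and> I \<noteq> {\<zero>\<^bsub>RL \<tau>\<^esub>} \<longrightarrow>
              (\<exists>e. idempotent_elem (RL \<tau>) e \<and> essential_in (RL \<tau>) I (PIdl\<^bsub>RL \<tau>\<^esub> e)))) \<and>
         ((\<forall>I. ideal I (RL \<tau>) \<and> I \<noteq> {\<zero>\<^bsub>RL \<tau>\<^esub>} \<longrightarrow>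
              (\<exists>e. idempotent_elem (RL \<tau>) e \<and> essential_in (RL \<tau>) I (PIdl\<^bsub>RL \<tau>\<^esub> e))) \<longleftrightarrow>
            CS_ring (RL \<tau>))"
proof -
  interpret topoframe \<tau> by fact
  interpret reduced_cring "RL \<tau>"
    using subframe_tau by (rule reduced_cring_RL)
  show ?thesis
    using extremally_disconnected_iff_Baer[OF assms] Baer_ring_iff_essential_in_PIdl
      CS_ring_iff_essential_in_PIdl
    by blast
qed

end
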